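(* Let $\mathbb{K}$ be a field of characteristic zero, let $D_n$ be the $n$-th Weyl algebra over $\mathbb{K}$, and let $f,g\in\mathbb{K}[x_1,\ldots,x_n]\setminus\{0\}$. Consider the homomorphism of left $D_n$-modules $$\tau: D_n\to D_n/\operatorname{Ann}_{D_n}(g^{-1}),\qquad q\mapsto qf,$$ where $qf$ stands for its class in the quotient. Then $\operatorname{Ann}_{D_n}\!\left(\frac{f}{g}\right)=\ker\tau$.
   Context: $D_n=\mathbb{K}\langle x_1,\ldots,x_n,\partial_1,\ldots,\partial_n\mid \partial_ix_i=x_i\partial_i+1,\ \partial_ix_j=x_j\partial_i\ (i\ne j)\rangle$, where the $x_i$ commute with one another and the $\partial_i$ commute with one another. It acts on rational functions in $\mathbb{K}(x_1,\ldots,x_n)$, with $x_i$ acting by multiplication and $\partial_i$ by partial differentiation $\partial/\partial x_i$; this action is written $\bullet$. For a rational function $r$, $\operatorname{Ann}_{D_n}(r)=\{q\in D_n\mid q\bullet r=0\}$, a left ideal. *)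

theory Defs
  imports
    "HOL-Library.Poly_Mapping"
    "HOL-Library.Set_Algebras"
    "HOL-Computational_Algebra.Fraction_Field"
begin

section \<open>Polynomials and rational functions\<close>

text \<open>
  The variables are indexed by a type \<open>'n\<close>; a finite \<open>'n\<close> with \<open>n\<close> elements gives
  \<open>K[x\<^sub>1, \<dots>, x\<^sub>n]\<close>. The linear order on \<open>'n\<close> is what the library needs to see that these
  polynomials form an integral domain. A polynomial maps exponent vectors to coefficients, and the
  multiplication of type \<open>_ \<Rightarrow>\<^sub>0 _\<close> is convolution.
\<close>

type_synonym ('n, 'k) polynomial = "('n \<Rightarrow>\<^sub>0 nat) \<Rightarrow>\<^sub>0 'k"
type_synonym ('n, 'k) rational = "('n, 'k) polynomial fract"

abbreviation expo :: "'n \<Rightarrow> 'n \<Rightarrow>\<^sub>0 nat" where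
  "expo i \<equiv> Poly_Mapping.single i 1"

definition poly_const :: "'k::zero \<Rightarrow> ('n, 'k) polynomial" where
  "poly_const c = Poly_Mapping.single 0 c"

definition poly_var :: "'n \<Rightarrow> ('n, 'k::zero_neq_one) polynomial" where
  "poly_var i = Poly_Mapping.single (expo i) 1"

definition rat_of_poly :: "('n::linorder, 'k::idom) polynomial \<Rightarrow> ('n, 'k) rational" where
  "rat_of_poly p = Fract p 1"

definition poly_partial :: "'n \<Rightarrow> ('n, 'k::comm_semiring_1) polynomial \<Rightarrow> ('n, 'k) polynomial" where
  "poly_partial i p =
    (\<Sum>m\<in>Poly_Mapping.keys p.
      Poly_Mapping.single (m - expo i) (of_nat (Poly_Mapping.lookup m i) * Poly_Mapping.lookup p m))"

lemma sum_keys_add: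
  fixes F :: "'a \<Rightarrow> 'b::monoid_add \<Rightarrow> 'c::comm_monoid_add"
  assumes "\<And>w. F w 0 = 0" "\<And>w a b. F w (a + b) = F w a + F w b"
  shows "(\<Sum>w\<in>Poly_Mapping.keys (p + q). F w (Poly_Mapping.lookup (p + q) w)) =
    (\<Sum>w\<in>Poly_Mapping.keys p. F w (Poly_Mapping.lookup p w)) +
    (\<Sum>w\<in>Poly_Mapping.keys q. F w (Poly_Mapping.lookup q w))"
  using assms by (rule setsum_keys_plus_distrib)

lemma poly_mapping_add_induct [case_names zero single add]:
  fixes p :: "'a \<Rightarrow>\<^sub>0 'b::monoid_add"
  assumes "P 0" "\<And>w c. P (Poly_Mapping.single w c)" "\<And>p q. P p \<Longrightarrow> P q \<Longrightarrow> P (p + q)"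
  shows "P p"
proof (induction p rule: Poly_Mapping.update_induct)
  case const
  show ?case by (rule assms(1))
next
  case (update f a b)
  have "Poly_Mapping.update a b f = Poly_Mapping.single a b + f"
    using update.hyps(1)
    by (intro poly_mapping_eqI)
      (auto simp: lookup_add lookup_update lookup_single when_def in_keys_iff)
  with assms(2,3) update.IH show ?case by simp
qed

lemma poly_partial_0 [simp]: "poly_partial i 0 = 0"
  by (simp add: poly_partial_def)

lemma poly_partial_add: "poly_partial i (p + q) = poly_partial i p + poly_partial i q"
  unfolding poly_partial_def
  by (rule sum_keys_add) (simp_all add: distrib_left single_add)

lemma poly_partial_single:
  "poly_partial i (Poly_Mapping.single m c) =
    Poly_Mapping.single (m - expo i) (of_nat (Poly_Mapping.lookup m i) * c)"
  by (simp add: poly_partial_def)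

lemma expo_diff_add:
  fixes m k :: "'n \<Rightarrow>\<^sub>0 nat"
  assumes "Poly_Mapping.lookup m i \<noteq> 0"
  shows "m - expo i + k = m + k - expo i"
  using assms
  by (intro poly_mapping_eqI) (auto simp: lookup_add lookup_minus lookup_single when_def)

lemma poly_partial_mult_single:
  fixes c d :: "'k::comm_semiring_1"
  shows "poly_partial i (Poly_Mapping.single m c * Poly_Mapping.single k d) =
    poly_partial i (Poly_Mapping.single m c) * Poly_Mapping.single k d +
    Poly_Mapping.single m c * poly_partial i (Poly_Mapping.single k d)"
proof -
  let ?m = "Poly_Mapping.lookup m i" and ?k = "Poly_Mapping.lookup k i"
  have "Poly_Mapping.single (m - expo i + k) (of_nat ?m * c * d) =
      Poly_Mapping.single (m + k - expo i) (of_nat ?m * c * d)"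
    using expo_diff_add[of m i k] by (cases "?m = 0") simp_all
  moreover have "Poly_Mapping.single (m + (k - expo i)) (c * (of_nat ?k * d)) =
      Poly_Mapping.single (m + k - expo i) (c * (of_nat ?k * d))"
    using expo_diff_add[of k i m] by (cases "?k = 0") (simp_all add: add.commute)
  ultimately show ?thesis
    by (simp add: poly_partial_single mult_single lookup_add single_add[symmetric] algebra_simps)
qed

lemma poly_partial_mult:
  fixes p q :: "('n, 'k::comm_semiring_1) polynomial"
  shows "poly_partial i (p * q) = poly_partial i p * q + p * poly_partial i q"
proof (induction p rule: poly_mapping_add_induct)
  case (single m c)
  show ?case
  proof (induction q rule: poly_mapping_add_induct)
    case (add q1 q2)
    then show ?case by (simp only: distrib_left poly_partial_add) (simp only: ac_simps)
  qed (simp_all add: poly_partial_mult_single)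
next
  case (add p1 p2)
  then show ?case by (simp only: distrib_right poly_partial_add) (simp only: ac_simps)
qed simp

lemma poly_partial_const [simp]: "poly_partial i (poly_const c) = 0"
  by (simp add: poly_const_def poly_partial_single)

lemma poly_partial_1 [simp]: "poly_partial i 1 = 0"
  using poly_partial_const[of i 1] by (simp add: poly_const_def)

lemma poly_partial_var:
  "poly_partial i (poly_var j :: ('n, 'k::comm_semiring_1) polynomial) = (if i = j then 1 else 0)"
  by (auto simp: poly_var_def poly_partial_single lookup_single)

lemma poly_partial_commute:
  fixes p :: "('n, 'k::comm_semiring_1) polynomial"
  shows "poly_partial i (poly_partial j p) = poly_partial j (poly_partial i p)"
proof (induction p rule: poly_mapping_add_induct)
  case (single m c)
  have "m - expo j - expo i = m - expo i - expo j"
    by (simp add: diff_diff_add add.commute)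
  then show ?case
    by (cases "i = j") (simp_all add: poly_partial_single lookup_minus lookup_single ac_simps)
qed (simp_all add: poly_partial_add)

lemma quotient_rule_cong:
  fixes a b c d a' b' c' d' :: "'a::comm_ring_1"
  assumes "a * d = c * b" "a' * d + a * d' = c' * b + c * b'"
  shows "(a' * b - a * b') * (d * d) = (c' * d - c * d') * (b * b)"
proof -
  have "(a' * b - a * b') * (d * d) - (c' * d - c * d') * (b * b) =
      ((a' * d + a * d') - (c' * b + c * b')) * (b * d) - (a * d - c * b) * (b' * d + b * d')"
    by (simp add: algebra_simps)
  then show ?thesis by (simp add: assms)
qed

text \<open>The partial derivative of \<open>a / b\<close>, by the quotient rule.\<close>

lift_definition rat_partial :: "'n::linorder \<Rightarrow> ('n, 'k::idom) rational \<Rightarrow> ('n, 'k) rational"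
  is "\<lambda>i (a, b). (poly_partial i a * b - a * poly_partial i b, b * b)"
proof (clarsimp)
  fix i :: 'n and a b c d :: "('n, 'k) polynomial"
  assume nz: "b \<noteq> 0" "d \<noteq> 0" and eq: "a * d = c * b"
  have "poly_partial i (a * d) = poly_partial i (c * b)" by (simp add: eq)
  then have "poly_partial i a * d + a * poly_partial i d =
      poly_partial i c * b + c * poly_partial i b"
    by (simp add: poly_partial_mult)
  with eq show "(poly_partial i a * b - a * poly_partial i b) * (d * d) =
      (poly_partial i c * d - c * poly_partial i d) * (b * b)"
    by (rule quotient_rule_cong)
qed

lemma rat_partial_Fract:
  assumes "b \<noteq> 0"
  shows "rat_partial i (Fract a b) = Fract (poly_partial i a * b - a * poly_partial i b) (b * b)"
  using assms by (simp add: Fract.abs_eq rat_partial.abs_eq eq_onp_def)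

lemma rat_of_poly_0 [simp]: "rat_of_poly 0 = 0"
  and rat_of_poly_1 [simp]: "rat_of_poly 1 = 1"
  and rat_of_poly_add: "rat_of_poly (p + q) = rat_of_poly p + rat_of_poly q"
  and rat_of_poly_diff: "rat_of_poly (p - q) = rat_of_poly p - rat_of_poly q"
  and rat_of_poly_mult: "rat_of_poly (p * q) = rat_of_poly p * rat_of_poly q"
  by (simp_all add: rat_of_poly_def fract_collapse)

lemma rat_of_poly_eq_0_iff [simp]: "rat_of_poly p = 0 \<longleftrightarrow> p = 0"
  by (simp add: rat_of_poly_def Zero_fract_def eq_fract)

lemma Fract_eq_rat_of_poly: "Fract a b = rat_of_poly a / rat_of_poly b"
  by (simp add: rat_of_poly_def)

lemma rat_cases:
  obtains a b where "r = rat_of_poly a / rat_of_poly b" "b \<noteq> 0"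
  by (cases r) (metis Fract_eq_rat_of_poly)

lemma rat_partial_divide:
  assumes "b \<noteq> 0"
  shows "rat_partial i (rat_of_poly a / rat_of_poly b) =
    (rat_of_poly (poly_partial i a) * rat_of_poly b - rat_of_poly a * rat_of_poly (poly_partial i b)) /
      (rat_of_poly b * rat_of_poly b)"
  using rat_partial_Fract[OF assms, of i a]
  by (simp only: Fract_eq_rat_of_poly rat_of_poly_diff rat_of_poly_mult)

lemma rat_partial_add: "rat_partial i (r + s) = rat_partial i r + rat_partial i s"
proof -
  obtain a b where r: "r = rat_of_poly a / rat_of_poly b" "b \<noteq> 0" by (rule rat_cases)
  obtain c d where s: "s = rat_of_poly c / rat_of_poly d" "d \<noteq> 0" by (rule rat_cases)
  have "r + s = rat_of_poly (a * d + c * b) / rat_of_poly (b * d)"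
    using r s by (simp add: rat_of_poly_add rat_of_poly_mult add_frac_eq)
  moreover have "b * d \<noteq> 0" using r s by simp
  ultimately have *: "rat_partial i (r + s) = (rat_of_poly (poly_partial i (a * d + c * b)) *
      rat_of_poly (b * d) - rat_of_poly (a * d + c * b) * rat_of_poly (poly_partial i (b * d))) /
      (rat_of_poly (b * d) * rat_of_poly (b * d))"
    by (metis rat_partial_divide)
  show ?thesis
    unfolding * unfolding r(1) s(1) rat_partial_divide[OF r(2)] rat_partial_divide[OF s(2)]
    using r(2) s(2)
    by (simp add: poly_partial_mult poly_partial_add rat_of_poly_add rat_of_poly_mult field_simps)
qed

lemma rat_partial_mult: "rat_partial i (r * s) = rat_partial i r * s + r * rat_partial i s"
proof -
  obtain a b where r: "r = rat_of_poly a / rat_of_poly b" "b \<noteq> 0" by (rule rat_cases)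
  obtain c d where s: "s = rat_of_poly c / rat_of_poly d" "d \<noteq> 0" by (rule rat_cases)
  have "r * s = rat_of_poly (a * c) / rat_of_poly (b * d)"
    using r s by (simp add: rat_of_poly_mult)
  moreover have "b * d \<noteq> 0" using r s by simp
  ultimately have *: "rat_partial i (r * s) = (rat_of_poly (poly_partial i (a * c)) *
      rat_of_poly (b * d) - rat_of_poly (a * c) * rat_of_poly (poly_partial i (b * d))) /
      (rat_of_poly (b * d) * rat_of_poly (b * d))"
    by (metis rat_partial_divide)
  show ?thesis
    unfolding * unfolding r(1) s(1) rat_partial_divide[OF r(2)] rat_partial_divide[OF s(2)]
    using r(2) s(2)
    by (simp add: poly_partial_mult rat_of_poly_add rat_of_poly_mult field_simps)
qed

lemma rat_partial_of_poly: "rat_partial i (rat_of_poly p) = rat_of_poly (poly_partial i p)"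
  by (simp add: rat_of_poly_def rat_partial_Fract)

lemma rat_partial_0 [simp]: "rat_partial i 0 = 0"
  using rat_partial_of_poly[of i 0] by simp

lemma rat_partial_diff: "rat_partial i (r - s) = rat_partial i r - rat_partial i s"
  using rat_partial_add[of i "r - s" s] by (simp add: algebra_simps)

lemma rat_partial_commute:
  fixes r :: "('n::linorder, 'k::idom) rational"
  shows "rat_partial i (rat_partial j r) = rat_partial j (rat_partial i r)"
proof -
  define E where "E = (\<lambda>r :: ('n, 'k) rational. rat_partial i (rat_partial j r) - rat_partial j (rat_partial i r))"
  have E_mult: "E (r * s) = E r * s + r * E s" for r s
    by (simp add: E_def rat_partial_mult rat_partial_add algebra_simps)
  have E_poly: "E (rat_of_poly p) = 0" for p
    by (simp add: E_def rat_partial_of_poly poly_partial_commute)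
  obtain a b where r: "r = Fract a b" "b \<noteq> 0" by (cases r)
  have "r * rat_of_poly b = rat_of_poly a"
    using r by (simp add: Fract_eq_rat_of_poly)
  then have "E r * rat_of_poly b = 0"
    using E_mult[of r "rat_of_poly b"] E_poly by simp
  with r have "E r = 0" by simp
  then show ?thesis by (simp add: E_def)
qed

section \<open>The Weyl algebra\<close>

subsection \<open>The free algebra\<close>

text \<open>Lists form the free monoid under concatenation; the free algebra is its monoid algebra.\<close>

instantiation list :: (type) monoid_add
begin

definition zero_list :: "'a list" where
  "zero_list = []"

definition plus_list :: "'a list \<Rightarrow> 'a list \<Rightarrow> 'a list" where
  "plus_list xs ys = xs @ ys"

instance
  by standard (simp_all add: zero_list_def plus_list_def)

end

datatype 'n weyl_gen = X 'n | D 'n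

type_synonym ('n, 'k) free_alg = "'n weyl_gen list \<Rightarrow>\<^sub>0 'k"

abbreviation word :: "'n weyl_gen list \<Rightarrow> ('n, 'k::zero_neq_one) free_alg" where
  "word w \<equiv> Poly_Mapping.single w 1"

inductive_set weyl_relators :: "('n, 'k::ring_1) free_alg set" where
  XX: "word [X i, X j] - word [X j, X i] \<in> weyl_relators"
| DD: "word [D i, D j] - word [D j, D i] \<in> weyl_relators"
| DX_same: "word [D i, X i] - (word [X i, D i] + 1) \<in> weyl_relators"
| DX_diff: "i \<noteq> j \<Longrightarrow> word [D i, X j] - word [X j, D i] \<in> weyl_relators"

text \<open>The two-sided ideal generated by a set.\<close>

inductive_set two_sided_ideal :: "'a::ring_1 set \<Rightarrow> 'a set" for S where
  gen: "s \<in> S \<Longrightarrow> s \<in> two_sided_ideal S"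
| zero: "0 \<in> two_sided_ideal S"
| add: "a \<in> two_sided_ideal S \<Longrightarrow> b \<in> two_sided_ideal S \<Longrightarrow> a + b \<in> two_sided_ideal S"
| mult_left: "a \<in> two_sided_ideal S \<Longrightarrow> r * a \<in> two_sided_ideal S"
| mult_right: "a \<in> two_sided_ideal S \<Longrightarrow> a * r \<in> two_sided_ideal S"

definition weyl_rel :: "('n, 'k::ring_1) free_alg \<Rightarrow> ('n, 'k) free_alg \<Rightarrow> bool" where
  "weyl_rel p q \<longleftrightarrow> p - q \<in> two_sided_ideal weyl_relators"

lemma two_sided_ideal_uminus: "a \<in> two_sided_ideal S \<Longrightarrow> - a \<in> two_sided_ideal S"
  using two_sided_ideal.mult_left[of a S "- 1"] by simp

lemma equivp_weyl_rel: "equivp weyl_rel"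
proof (rule equivpI)
  show "reflp weyl_rel"
    by (simp add: reflp_def weyl_rel_def two_sided_ideal.zero)
  show "symp weyl_rel"
    by (rule sympI) (use two_sided_ideal_uminus in \<open>fastforce simp: weyl_rel_def\<close>)
  show "transp weyl_rel"
    by (rule transpI) (use two_sided_ideal.add in \<open>fastforce simp: weyl_rel_def\<close>)
qed

subsection \<open>The action of the free algebra on rational functions\<close>

fun gen_act :: "'n::linorder weyl_gen \<Rightarrow> ('n, 'k::idom) rational \<Rightarrow> ('n, 'k) rational" where
  "gen_act (X i) r = rat_of_poly (poly_var i) * r"
| "gen_act (D i) r = rat_partial i r"

definition word_act :: "'n::linorder weyl_gen list \<Rightarrow> ('n, 'k::idom) rational \<Rightarrow> ('n, 'k) rational" where
  "word_act w r = foldr gen_act w r"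

definition free_act :: "('n::linorder, 'k::idom) free_alg \<Rightarrow> ('n, 'k) rational \<Rightarrow> ('n, 'k) rational" where
  "free_act p r =
    (\<Sum>w\<in>Poly_Mapping.keys p. rat_of_poly (poly_const (Poly_Mapping.lookup p w)) * word_act w r)"

lemma word_act_simps [simp]:
  "word_act [] r = r"
  "word_act (a # w) r = gen_act a (word_act w r)"
  by (simp_all add: word_act_def)

lemma word_act_append: "word_act (v @ w) r = word_act v (word_act w r)"
  by (simp add: word_act_def)

lemma word_act_0 [simp]: "word_act w 0 = 0"
proof (induction w)
  case (Cons a w)
  then show ?case by (cases a) simp_all
qed simp

lemma gen_act_add: "gen_act a (r + s) = gen_act a r + gen_act a s"
  by (cases a) (simp_all add: rat_partial_add distrib_left)

lemma word_act_add: "word_act w (r + s) = word_act w r + word_act w s"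
  by (induction w) (simp_all add: gen_act_add)

lemma word_act_scale:
  "word_act w (rat_of_poly (poly_const c) * r) = rat_of_poly (poly_const c) * word_act w r"
proof (induction w)
  case (Cons a w)
  then show ?case
    by (cases a) (simp_all add: rat_partial_mult rat_partial_of_poly ac_simps)
qed simp

lemma poly_const_0 [simp]: "poly_const 0 = 0"
  and poly_const_add: "poly_const (a + b) = poly_const a + poly_const b"
  by (simp_all add: poly_const_def single_add)

lemma poly_const_1 [simp]: "poly_const 1 = 1"
  by (simp add: poly_const_def)

lemma poly_const_mult:
  "poly_const (a * b) = poly_const a * (poly_const b :: ('n, 'k::semiring_0) polynomial)"
  by (simp add: poly_const_def mult_single)

lemma free_act_0 [simp]: "free_act 0 r = 0"
  by (simp add: free_act_def)

lemma free_act_0_right [simp]: "free_act p 0 = 0"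
  by (simp add: free_act_def)

lemma free_act_add: "free_act (p + q) r = free_act p r + free_act q r"
  unfolding free_act_def
  by (rule sum_keys_add) (simp_all add: poly_const_add rat_of_poly_add distrib_right)

lemma free_act_add_right: "free_act p (r + s) = free_act p r + free_act p s"
  by (simp add: free_act_def word_act_add distrib_left sum.distrib)

lemma free_act_single:
  "free_act (Poly_Mapping.single w c) r = rat_of_poly (poly_const c) * word_act w r"
  by (simp add: free_act_def)

lemma free_act_diff: "free_act (p - q) r = free_act p r - free_act q r"
  using free_act_add[of "p - q" q r] by (simp add: algebra_simps)

lemma free_act_1 [simp]: "free_act 1 r = r"
proof -
  have "free_act 1 r = free_act (Poly_Mapping.single 0 1) r" by (simp only: single_one)
  also have "\<dots> = r" by (simp only: free_act_single) (simp add: zero_list_def)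
  finally show ?thesis .
qed

lemma free_act_mult: "free_act (p * q) r = free_act p (free_act q r)"
proof (induction p rule: poly_mapping_add_induct)
  case (single v c)
  show ?case
  proof (induction q rule: poly_mapping_add_induct)
    case (single w d)
    show ?case
      by (simp add: mult_single free_act_single plus_list_def word_act_append word_act_scale
          poly_const_mult rat_of_poly_mult ac_simps)
  qed (simp_all add: distrib_left free_act_add free_act_add_right)
qed (simp_all add: distrib_right free_act_add)

lemma free_act_relator: "p \<in> weyl_relators \<Longrightarrow> free_act p r = 0"
  by (induction rule: weyl_relators.induct)
    (simp_all add: free_act_diff free_act_add free_act_single rat_partial_commute rat_partial_mult
      rat_partial_of_poly poly_partial_var ac_simps)

lemma free_act_ideal: "p \<in> two_sided_ideal weyl_relators \<Longrightarrow> free_act p r = 0"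
  by (induction arbitrary: r rule: two_sided_ideal.induct)
    (simp_all add: free_act_relator free_act_add free_act_mult)

subsection \<open>The quotient\<close>

quotient_type (overloaded) ('n, 'k) weyl = "('n, 'k::field) free_alg" / weyl_rel
  by (rule equivp_weyl_rel)

lemma weyl_rel_add: "weyl_rel p p' \<Longrightarrow> weyl_rel q q' \<Longrightarrow> weyl_rel (p + q) (p' + q')"
  unfolding weyl_rel_def
  by (drule (1) two_sided_ideal.add) (simp add: algebra_simps)

lemma weyl_rel_uminus: "weyl_rel p p' \<Longrightarrow> weyl_rel (- p) (- p')"
  unfolding weyl_rel_def by (drule two_sided_ideal_uminus) simp

lemma weyl_rel_mult:
  assumes "weyl_rel p p'" "weyl_rel q q'"
  shows "weyl_rel (p * q) (p' * q')"
proof -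
  have "(p - p') * q + p' * (q - q') \<in> two_sided_ideal weyl_relators"
    using assms unfolding weyl_rel_def
    by (intro two_sided_ideal.add two_sided_ideal.mult_left two_sided_ideal.mult_right)
  then show ?thesis by (simp add: weyl_rel_def algebra_simps)
qed

instantiation weyl :: (linorder, field) ring_1
begin

lift_definition zero_weyl :: "('a, 'b) weyl" is 0 .
lift_definition one_weyl :: "('a, 'b) weyl" is 1 .
lift_definition plus_weyl :: "('a, 'b) weyl \<Rightarrow> ('a, 'b) weyl \<Rightarrow> ('a, 'b) weyl" is "(+)"
  by (rule weyl_rel_add)
lift_definition uminus_weyl :: "('a, 'b) weyl \<Rightarrow> ('a, 'b) weyl" is uminus
  by (rule weyl_rel_uminus)
lift_definition minus_weyl :: "('a, 'b) weyl \<Rightarrow> ('a, 'b) weyl \<Rightarrow> ('a, 'b) weyl" is "(-)"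
  using weyl_rel_add weyl_rel_uminus by (metis add_uminus_conv_diff)
lift_definition times_weyl :: "('a, 'b) weyl \<Rightarrow> ('a, 'b) weyl \<Rightarrow> ('a, 'b) weyl" is "(*)"
  by (rule weyl_rel_mult)

instance
proof
  have "\<not> weyl_rel (0 :: ('a, 'b) free_alg) 1"
  proof
    assume "weyl_rel (0 :: ('a, 'b) free_alg) 1"
    then have "free_act (0 - 1 :: ('a, 'b) free_alg) 1 = 0"
      unfolding weyl_rel_def by (rule free_act_ideal)
    then show False by (simp only: free_act_diff) simp
  qed
  then show "(0 :: ('a, 'b) weyl) \<noteq> 1" by transfer
qed (transfer, simp add: algebra_simps equivp_reflp[OF equivp_weyl_rel])+

end

lift_definition weyl_act :: "('n::linorder, 'k::field) weyl \<Rightarrow> ('n, 'k) rational \<Rightarrow> ('n, 'k) rational"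
    (infixr \<open>\<bullet>\<close> 75)
  is free_act
proof -
  fix p q :: "('n, 'k) free_alg"
  assume "weyl_rel p q"
  then have "free_act (p - q) r = 0" for r
    unfolding weyl_rel_def by (rule free_act_ideal)
  then show "free_act p = free_act q" by (auto simp: free_act_diff)
qed

lift_definition weyl_const :: "'k::field \<Rightarrow> ('n::linorder, 'k) weyl" is "Poly_Mapping.single []" .
lift_definition weyl_x :: "'n::linorder \<Rightarrow> ('n, 'k::field) weyl" is "\<lambda>i. word [X i]" .
lift_definition weyl_d :: "'n::linorder \<Rightarrow> ('n, 'k::field) weyl" is "\<lambda>i. word [D i]" .

lemma weyl_relations:
  fixes i j :: "'n::linorder"
  shows "weyl_x i * weyl_x j = (weyl_x j * weyl_x i :: ('n, 'k::field) weyl)"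
    and "weyl_d i * weyl_d j = (weyl_d j * weyl_d i :: ('n, 'k) weyl)"
    and "weyl_d i * weyl_x i = (weyl_x i * weyl_d i + 1 :: ('n, 'k) weyl)"
    and "i \<noteq> j \<Longrightarrow> weyl_d i * weyl_x j = (weyl_x j * weyl_d i :: ('n, 'k) weyl)"
  by (transfer, simp add: weyl_rel_def mult_single plus_list_def two_sided_ideal.gen
      weyl_relators.intros)+

lemma
  fixes r :: "('n::linorder, 'k::field) rational"
  shows weyl_act_const [simp]: "weyl_const c \<bullet> r = rat_of_poly (poly_const c) * r"
  and weyl_act_x [simp]: "weyl_x i \<bullet> r = rat_of_poly (poly_var i) * r"
  and weyl_act_d [simp]: "weyl_d i \<bullet> r = rat_partial i r"
  by (simp_all add: weyl_const.abs_eq weyl_x.abs_eq weyl_d.abs_eq weyl_act.abs_eq free_act_single)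

lemma
  fixes p q :: "('n::linorder, 'k::field) weyl" and r s :: "('n, 'k) rational"
  shows weyl_act_1 [simp]: "1 \<bullet> r = r"
  and weyl_act_mult: "(p * q) \<bullet> r = p \<bullet> q \<bullet> r"
  and weyl_act_0 [simp]: "0 \<bullet> r = 0"
  and weyl_act_0_right [simp]: "p \<bullet> 0 = 0"
  and weyl_act_add: "(p + q) \<bullet> r = p \<bullet> r + q \<bullet> r"
  and weyl_act_add_right: "p \<bullet> (r + s) = p \<bullet> r + p \<bullet> s"
proof -
  obtain p' q' where "p = abs_weyl p'" "q = abs_weyl q'"
    by (metis Quotient_abs_rep[OF Quotient_weyl])
  note * = this weyl_act.abs_eq zero_weyl.abs_eq one_weyl.abs_eq plus_weyl.abs_eq times_weyl.abs_eq
  show "1 \<bullet> r = r" "(p * q) \<bullet> r = p \<bullet> q \<bullet> r" "0 \<bullet> r = 0" "p \<bullet> 0 = 0"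
    "(p + q) \<bullet> r = p \<bullet> r + q \<bullet> r" "p \<bullet> (r + s) = p \<bullet> r + p \<bullet> s"
    by (simp_all add: * free_act_mult free_act_add free_act_add_right)
qed

text \<open>
  The inclusion of \<open>K[x\<^sub>1, \<dots>, x\<^sub>n]\<close> into the Weyl algebra. As the \<open>x\<^sub>i\<close> commute, the order of the
  factors in a monomial does not matter; the increasing one is used.
\<close>

definition weyl_monom :: "('n::linorder \<Rightarrow>\<^sub>0 nat) \<Rightarrow> ('n, 'k::field) weyl" where
  "weyl_monom m =
    prod_list (map (\<lambda>i. weyl_x i ^ Poly_Mapping.lookup m i)
      (sorted_list_of_set (Poly_Mapping.keys m)))"

definition weyl_of_poly :: "('n::linorder, 'k::field) polynomial \<Rightarrow> ('n, 'k) weyl" where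
  "weyl_of_poly p =
    (\<Sum>m\<in>Poly_Mapping.keys p. weyl_const (Poly_Mapping.lookup p m) * weyl_monom m)"

definition weyl_Ann :: "('n::linorder, 'k::field) rational \<Rightarrow> ('n, 'k) weyl set" where
  "weyl_Ann r = {q. q \<bullet> r = 0}"

section \<open>Left modules\<close>

text \<open>The library only has modules over commutative rings.\<close>

record ('r, 'm) lmodule =
  lcarrier :: "'m set"
  ladd :: "'m \<Rightarrow> 'm \<Rightarrow> 'm"
  lzero :: 'm
  lscale :: "'r \<Rightarrow> 'm \<Rightarrow> 'm"

locale left_module =
  fixes M :: "('r::ring_1, 'm) lmodule"
  assumes zero_closed: "lzero M \<in> lcarrier M"
    and add_closed: "\<lbrakk>u \<in> lcarrier M; v \<in> lcarrier M\<rbrakk> \<Longrightarrow> ladd M u v \<in> lcarrier M"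
    and scale_closed: "u \<in> lcarrier M \<Longrightarrow> lscale M a u \<in> lcarrier M"
    and add_assoc: "\<lbrakk>u \<in> lcarrier M; v \<in> lcarrier M; w \<in> lcarrier M\<rbrakk>
      \<Longrightarrow> ladd M (ladd M u v) w = ladd M u (ladd M v w)"
    and add_commute: "\<lbrakk>u \<in> lcarrier M; v \<in> lcarrier M\<rbrakk> \<Longrightarrow> ladd M u v = ladd M v u"
    and add_zero: "u \<in> lcarrier M \<Longrightarrow> ladd M (lzero M) u = u"
    and add_inverse: "u \<in> lcarrier M \<Longrightarrow> \<exists>v\<in>lcarrier M. ladd M v u = lzero M"
    and scale_add_right: "\<lbrakk>u \<in> lcarrier M; v \<in> lcarrier M\<rbrakk>
      \<Longrightarrow> lscale M a (ladd M u v) = ladd M (lscale M a u) (lscale M a v)"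
    and scale_add_left: "u \<in> lcarrier M
      \<Longrightarrow> lscale M (a + b) u = ladd M (lscale M a u) (lscale M b u)"
    and scale_mult: "u \<in> lcarrier M \<Longrightarrow> lscale M (a * b) u = lscale M a (lscale M b u)"
    and scale_one: "u \<in> lcarrier M \<Longrightarrow> lscale M 1 u = u"

locale left_module_hom =
  source: left_module M + target: left_module N
  for M :: "('r::ring_1, 'm) lmodule" and N :: "('r, 'n) lmodule" +
  fixes h :: "'m \<Rightarrow> 'n"
  assumes hom_closed: "u \<in> lcarrier M \<Longrightarrow> h u \<in> lcarrier N"
    and hom_add: "\<lbrakk>u \<in> lcarrier M; v \<in> lcarrier M\<rbrakk> \<Longrightarrow> h (ladd M u v) = ladd N (h u) (h v)"
    and hom_scale: "u \<in> lcarrier M \<Longrightarrow> h (lscale M a u) = lscale N a (h u)"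

definition left_module_kernel ::
    "('r, 'm) lmodule \<Rightarrow> ('r, 'n) lmodule \<Rightarrow> ('m \<Rightarrow> 'n) \<Rightarrow> 'm set" where
  "left_module_kernel M N h = {u \<in> lcarrier M. h u = lzero N}"

definition left_ideal :: "'a::ring_1 set \<Rightarrow> bool" where
  "left_ideal I \<longleftrightarrow> 0 \<in> I \<and> (\<forall>a\<in>I. \<forall>b\<in>I. a + b \<in> I) \<and> (\<forall>r. \<forall>a\<in>I. r * a \<in> I)"

definition regular_module :: "('a::ring_1, 'a) lmodule" where
  "regular_module = \<lparr>lcarrier = UNIV, ladd = (+), lzero = 0, lscale = (*)\<rparr>"

text \<open>
  The quotient of the regular module by a left ideal \<open>I\<close>. The class of \<open>p\<close> is \<open>p +o I\<close>.
  Addition is the sum of sets. For the scalar multiplication, \<open>a *o (p +o I)\<close> may be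
  properly contained in the class of \<open>a * p\<close>, hence the additional summand \<open>I\<close>.
\<close>

definition quotient_module :: "'a::ring_1 set \<Rightarrow> ('a, 'a set) lmodule" where
  "quotient_module I =
    \<lparr>lcarrier = {p +o I | p. True}, ladd = (+), lzero = I, lscale = (\<lambda>a C. a *o C + I)\<rparr>"

lemma left_module_regular: "left_module (regular_module :: ('a::ring_1, 'a) lmodule)"
  by unfold_locales
    (auto simp: regular_module_def algebra_simps intro: exI[of _ "- _"])

context
  fixes I :: "'a::ring_1 set"
  assumes I: "left_ideal I"
begin

lemma left_ideal_zero: "0 \<in> I"
  and left_ideal_add: "a \<in> I \<Longrightarrow> b \<in> I \<Longrightarrow> a + b \<in> I"
  and left_ideal_mult: "a \<in> I \<Longrightarrow> r * a \<in> I"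
  using I by (auto simp: left_ideal_def)

lemma class_add: "(p +o I) + (q +o I) = (p + q) +o I"
proof (intro set_eqI iffI)
  fix x assume "x \<in> (p +o I) + (q +o I)"
  then obtain a b where "a \<in> I" "b \<in> I" "x = (p + a) + (q + b)"
    by (auto simp: elt_set_plus_def set_plus_def)
  then show "x \<in> (p + q) +o I"
    using left_ideal_add[of a b] by (auto simp: elt_set_plus_def algebra_simps)
next
  fix x assume "x \<in> (p + q) +o I"
  then obtain a where "a \<in> I" "x = (p + a) + (q + 0)"
    by (auto simp: elt_set_plus_def algebra_simps)
  then show "x \<in> (p +o I) + (q +o I)"
    using left_ideal_zero unfolding elt_set_plus_def set_plus_def by blast
qed

lemma class_zero: "0 +o I = I"
  by (simp add: elt_set_plus_def)

lemma class_scale: "a *o (p +o I) + I = (a * p) +o I"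
proof (intro set_eqI iffI)
  fix x assume "x \<in> a *o (p +o I) + I"
  then obtain b c where "b \<in> I" "c \<in> I" "x = a * (p + b) + c"
    by (auto simp: elt_set_plus_def set_plus_def elt_set_times_def)
  then show "x \<in> (a * p) +o I"
    using left_ideal_add[OF left_ideal_mult[of b a], of c]
    by (auto simp: elt_set_plus_def algebra_simps)
next
  fix x assume "x \<in> (a * p) +o I"
  then obtain c where "c \<in> I" "x = a * (p + 0) + c"
    by (auto simp: elt_set_plus_def)
  then show "x \<in> a *o (p +o I) + I"
    using left_ideal_zero unfolding elt_set_plus_def set_plus_def elt_set_times_def by blast
qed

lemma class_eq_zero_iff: "p +o I = I \<longleftrightarrow> p \<in> I"
proof
  assume "p +o I = I"
  then show "p \<in> I"
    using left_ideal_zero by (force simp: elt_set_plus_def)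
next
  assume p: "p \<in> I"
  have "x \<in> p +o I" if "x \<in> I" for x
    using that left_ideal_add[OF left_ideal_mult[OF p, of "- 1"] that]
    by (force simp: elt_set_plus_def)
  with p show "p +o I = I"
    using left_ideal_add by (auto simp: elt_set_plus_def)
qed

lemma left_module_quotient: "left_module (quotient_module I)"
proof unfold_locales
  fix u assume "u \<in> lcarrier (quotient_module I)"
  then obtain p where u: "u = p +o I" by (auto simp: quotient_module_def)
  show "\<exists>v\<in>lcarrier (quotient_module I). ladd (quotient_module I) v u = lzero (quotient_module I)"
    by (rule bexI[of _ "(- p) +o I"])
      (auto simp: quotient_module_def u class_add class_zero)
next
  show "lzero (quotient_module I) \<in> lcarrier (quotient_module I)"
    by (auto simp: quotient_module_def intro: exI[of _ 0] simp: class_zero)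
next
  fix u assume "u \<in> lcarrier (quotient_module I)"
  then obtain p where u: "u = p +o I" by (auto simp: quotient_module_def)
  show "ladd (quotient_module I) (lzero (quotient_module I)) u = u"
    using class_add[of 0 p] by (simp add: quotient_module_def u class_zero)
next
  fix u v assume "u \<in> lcarrier (quotient_module I)" "v \<in> lcarrier (quotient_module I)"
  then show "ladd (quotient_module I) u v = ladd (quotient_module I) v u"
    by (simp add: quotient_module_def add.commute)
next
  fix u v w :: "'a set"
  show "ladd (quotient_module I) (ladd (quotient_module I) u v) w =
      ladd (quotient_module I) u (ladd (quotient_module I) v w)"
    by (simp add: quotient_module_def add.assoc)
qed (auto simp: quotient_module_def class_add class_scale mult.assoc distrib_left distrib_right)

end

lemma left_ideal_weyl_Ann: "left_ideal (weyl_Ann r)"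
  by (auto simp: left_ideal_def weyl_Ann_def weyl_act_add weyl_act_mult)

section \<open>The homomorphism\<close>

definition tau :: "('n::linorder, 'k::field) polynomial \<Rightarrow> ('n, 'k) polynomial
    \<Rightarrow> ('n, 'k) weyl \<Rightarrow> ('n, 'k) weyl set" where
  "tau f g q = (q * weyl_of_poly f) +o weyl_Ann (inverse (rat_of_poly g))"

lemma tau_hom:
  "left_module_hom regular_module (quotient_module (weyl_Ann (inverse (rat_of_poly g)))) (tau f g)"
proof -
  note ideal = left_ideal_weyl_Ann[of "inverse (rat_of_poly g)"]
  interpret N: left_module "quotient_module (weyl_Ann (inverse (rat_of_poly g)))"
    by (rule left_module_quotient[OF ideal])
  interpret M: left_module "regular_module :: (('a, 'b) weyl, ('a, 'b) weyl) lmodule"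
    by (rule left_module_regular)
  show ?thesis
    by unfold_locales
      (auto simp: regular_module_def quotient_module_def tau_def class_add[OF ideal]
        class_scale[OF ideal] distrib_right mult.assoc)
qed

end

theory Submission
  imports Defs
begin

text \<open>Inside the Weyl algebra a polynomial acts by multiplication
  (\<open>weyl_act_of_poly\<close>), and a product acts by composition
  (\<open>weyl_act_mult\<close>). So applying q to f/g = f * (1/g) is the same as applying q*f to
  1/g. Hence q kills f/g iff q*f annihilates 1/g, that is, iff the class of q*f in the quotient
  vanishes (\<open>class_eq_zero_iff\<close>). The work lies in \<open>weyl_act_of_poly\<close>,
  which is built up from powers of one variable through monomials to linear combinations.\<close>

text \<open>Needed at two levels: for an exponent vector split into its single-variable parts, and
  for a polynomial split into its terms.\<close>

lemma sum_single_lookup: "(\<Sum>m\<in>Poly_Mapping.keys p. Poly_Mapping.single m (Poly_Mapping.lookup p m)) = p"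
  by (rule poly_mapping_eqI)
    (simp add: lookup_sum lookup_single when_def in_keys_iff)

lemma sum_weyl_act: "(\<Sum>a\<in>A. q a) \<bullet> r = (\<Sum>a\<in>A. q a \<bullet> r)"
  by (induction A rule: infinite_finite_induct) (simp_all add: weyl_act_add)

lemma rat_of_poly_sum: "rat_of_poly (\<Sum>a\<in>A. p a) = (\<Sum>a\<in>A. rat_of_poly (p a))"
  by (induction A rule: infinite_finite_induct) (simp_all add: rat_of_poly_add)

lemma weyl_act_x_power:
  fixes r :: "('n::linorder, 'k::field) rational"
  shows "weyl_x i ^ k \<bullet> r = rat_of_poly (Poly_Mapping.single (Poly_Mapping.single i k) 1) * r"
proof (induction k)
  case 0
  then show ?case by simp
next
  case (Suc k)
  have "Poly_Mapping.single (Poly_Mapping.single i (Suc k)) (1 :: 'k) =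
      poly_var i * Poly_Mapping.single (Poly_Mapping.single i k) 1"
    by (simp add: poly_var_def mult_single single_add[symmetric])
  with Suc show ?case by (simp add: weyl_act_mult rat_of_poly_mult mult.assoc)
qed

text \<open>Stated for an arbitrary list and arbitrary exponents so that induction on the list
  applies; an index that recurs just adds its exponent again.\<close>

lemma weyl_act_prod_list_x_power:
  fixes r :: "('n::linorder, 'k::field) rational"
  shows "prod_list (map (\<lambda>i. weyl_x i ^ e i) is) \<bullet> r =
    rat_of_poly (Poly_Mapping.single (\<Sum>i\<leftarrow>is. Poly_Mapping.single i (e i)) 1) * r"
proof (induction "is")
  case (Cons i "is")
  have "Poly_Mapping.single (\<Sum>i\<leftarrow>i # is. Poly_Mapping.single i (e i)) (1 :: 'k) =
      Poly_Mapping.single (Poly_Mapping.single i (e i)) 1 *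
      Poly_Mapping.single (\<Sum>i\<leftarrow>is. Poly_Mapping.single i (e i)) 1"
    by (simp add: mult_single)
  with Cons show ?case
    by (simp add: weyl_act_mult weyl_act_x_power rat_of_poly_mult mult.assoc)
qed simp

lemma weyl_act_monom: "weyl_monom m \<bullet> r = rat_of_poly (Poly_Mapping.single m 1) * r"
  \<comment> \<open>The sorted list of the support has no repetitions, so the list sum is a sum over
    \<open>keys m\<close>, which recovers \<open>m\<close>.\<close>
  by (simp add: weyl_monom_def weyl_act_prod_list_x_power sum_list_distinct_conv_sum_set
      sum_single_lookup)

lemma weyl_act_of_poly: "weyl_of_poly p \<bullet> r = rat_of_poly p * r"
proof -
  have "weyl_of_poly p \<bullet> r = (\<Sum>m\<in>Poly_Mapping.keys p.
      rat_of_poly (poly_const (Poly_Mapping.lookup p m) * Poly_Mapping.single m 1)) * r"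
    by (simp add: weyl_of_poly_def sum_weyl_act weyl_act_mult weyl_act_monom rat_of_poly_mult
        sum_distrib_right mult.assoc)
  also have "\<dots> = rat_of_poly p * r"
    by (simp add: poly_const_def mult_single sum_single_lookup flip: rat_of_poly_sum)
  finally show ?thesis .
qed

theorem lemma4p6:
  fixes f g :: "('n::{finite, linorder}, 'k::field_char_0) polynomial"
  assumes "f \<noteq> 0" and "g \<noteq> 0"
  shows "weyl_Ann (rat_of_poly f / rat_of_poly g) =
    left_module_kernel regular_module
      (quotient_module (weyl_Ann (inverse (rat_of_poly g)))) (tau f g)"
proof (rule set_eqI)
  fix q :: "('n, 'k) weyl"
  have "q \<in> weyl_Ann (rat_of_poly f / rat_of_poly g) \<longleftrightarrow>
      q * weyl_of_poly f \<in> weyl_Ann (inverse (rat_of_poly g))"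
    by (simp add: weyl_Ann_def weyl_act_mult weyl_act_of_poly divide_inverse)
  \<comment> \<open>The zero of the quotient module is the annihilator itself, and a coset equals
    the ideal iff its representative lies in it.\<close>
  also have "\<dots> \<longleftrightarrow> tau f g q = weyl_Ann (inverse (rat_of_poly g))"
    by (simp add: tau_def class_eq_zero_iff[OF left_ideal_weyl_Ann])
  finally show "q \<in> weyl_Ann (rat_of_poly f / rat_of_poly g) \<longleftrightarrow>
      q \<in> left_module_kernel regular_module
        (quotient_module (weyl_Ann (inverse (rat_of_poly g)))) (tau f g)"
    by (simp add: left_module_kernel_def regular_module_def quotient_module_def)
qed

end
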